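(* Let $A$ be a Marot ring. Then $A$ is a regular-Noetherian SP-ring if and only if $A$ is a Dedekind ring.
   Context: All rings are commutative with $1$. A regular element is a non-zerodivisor, and a regular ideal is an ideal containing a regular element. A Marot ring is a ring in which every regular ideal is generated by regular elements. An ideal $I$ is radical if $\sqrt{I}=I$ (the whole ring counts as a radical ideal). An SP-ring is a ring in which every regular ideal is a (finite) product of radical ideals. A regular-Noetherian ring is a ring whose regular ideals are finitely generated. A Dedekind ring is a ring whose regular ideals are products of prime ideals (the whole ring being the empty product). *)

theory Defs
  imports "HOL-Algebra.Ideal_Product"
begin

definition regular_elements :: "('a, 'b) ring_scheme \<Rightarrow> 'a set" where
  "regular_elements R =
     {a \<in> carrier R. \<forall>x \<in> carrier R. a \<otimes>\<^bsub>R\<^esub> x = \<zero>\<^bsub>R\<^esub> \<longrightarrow> x = \<zero>\<^bsub>R\<^esub>}"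

definition regular_ideal :: "'a set \<Rightarrow> ('a, 'b) ring_scheme \<Rightarrow> bool" where
  "regular_ideal I R \<longleftrightarrow> ideal I R \<and> I \<inter> regular_elements R \<noteq> {}"

definition radical_of :: "('a, 'b) ring_scheme \<Rightarrow> 'a set \<Rightarrow> 'a set" where
  "radical_of R I = {x \<in> carrier R. \<exists>n::nat. n > 0 \<and> x [^]\<^bsub>R\<^esub> n \<in> I}"

definition radical_ideal :: "'a set \<Rightarrow> ('a, 'b) ring_scheme \<Rightarrow> bool" where
  "radical_ideal I R \<longleftrightarrow> ideal I R \<and> radical_of R I = I"

text \<open>The empty product is the whole ring, the unit for multiplication of ideals.\<close>

definition ideal_list_prod :: "('a, 'b) ring_scheme \<Rightarrow> 'a set list \<Rightarrow> 'a set" where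
  "ideal_list_prod R Js = foldr (ideal_prod R) Js (carrier R)"

locale marot_ring = cring +
  assumes regular_generators:
    "regular_ideal I R \<Longrightarrow> \<exists>S \<subseteq> regular_elements R. I = Idl S"

locale sp_ring = cring +
  assumes radical_factorization:
    "regular_ideal I R \<Longrightarrow>
       \<exists>Js. (\<forall>J \<in> set Js. radical_ideal J R) \<and> I = ideal_list_prod R Js"

locale regular_noetherian_ring = cring +
  assumes regular_finitely_generated:
    "regular_ideal I R \<Longrightarrow> \<exists>S \<subseteq> carrier R. finite S \<and> I = Idl S"

text \<open>The factorization condition is imposed on regular ideals only, so
  a Dedekind ring may have zero divisors.\<close>

locale dedekind_ring = cring +
  assumes prime_factorization:
    "regular_ideal I R \<Longrightarrow>
       \<exists>Ps. (\<forall>P \<in> set Ps. primeideal P R) \<and> I = ideal_list_prod R Ps"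

end

theory Submission
  imports Defs "HOL-Algebra.Ring_Divisibility"
begin

text \<open>
  Everything rests on one fact about SP-rings: a finitely generated regular prime \<open>P\<close> is maximal, as
  soon as each regular ideal contains a product of primes above it (\<open>fg_regular_prime_maximal\<close>).
  The reason is local. If \<open>P\<close> were not maximal, there would be a prime \<open>M\<close>, minimal over \<open>P + (b)\<close>
  with \<open>b \<notin> P\<close>, at which \<open>P + (b)\<close> becomes a power of \<open>M\<close>. So \<open>M\<close> is invertible modulo \<open>P\<close> and
  locally \<open>M = P + (c)\<close>. Applied to \<open>c\<^sup>2\<close>, the radical factorization gives \<open>P \<subseteq> M\<^sup>2\<close>; this implies
  \<open>P = M P\<close>, and Nakayama's lemma yields \<open>P = 0\<close> locally, contrary to regularity.

  In a regular-Noetherian ring, Noetherian induction puts a product of primes below every regular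
  ideal (\<open>regular_has_prime_product\<close>). With the SP property those primes are maximal, so a regular
  radical ideal is a finite intersection, and thus a product, of maximal ideals; regular ideals, being
  products of such radical ideals, are products of primes.

  Conversely, prime ideals are radical, so a Dedekind ring is an SP-ring. The prime factors of
  \<open>(a)\<close> for a regular \<open>a\<close> are invertible, hence finitely generated
  (\<open>divides_regular_principal_fg\<close>), hence maximal. Every regular prime contains such a factor and so is
  equal to it. Therefore regular ideals are products of invertible ideals, and such products are
  invertible and finitely generated.
\<close>

section \<open>Products of ideals\<close>

lemma (in cring) ideal_prod_leI:
  assumes "ideal K R" "\<And>i j. i \<in> I \<Longrightarrow> j \<in> J \<Longrightarrow> i \<otimes> j \<in> K"
  shows "I \<cdot> J \<subseteq> K"
proof
  interpret K: ideal K R by fact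
  fix x assume "x \<in> I \<cdot> J"
  then show "x \<in> K" by induct (use assms in auto)
qed

lemma (in cring) ideal_prod_mono:
  assumes "I \<subseteq> I'" "J \<subseteq> J'"
  shows "I \<cdot> J \<subseteq> I' \<cdot> J'"
proof
  fix x assume "x \<in> I \<cdot> J"
  then show "x \<in> I' \<cdot> J'"
    by induct (use assms in \<open>auto intro: ideal_prod.intros\<close>)
qed

lemma (in cring) carrier_ideal_prod: "ideal I R \<Longrightarrow> carrier R \<cdot> I = I"
  using ideal_prod_commute[OF oneideal] ideal_prod_one by simp

lemma ideal_list_prod_Nil [simp]: "ideal_list_prod R [] = carrier R"
  by (simp add: ideal_list_prod_def)

lemma ideal_list_prod_Cons [simp]:
  "ideal_list_prod R (J # Js) = J \<cdot>\<^bsub>R\<^esub> ideal_list_prod R Js"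
  by (simp add: ideal_list_prod_def)

lemma (in cring) ideal_list_prod_is_ideal:
  "\<forall>J\<in>set Js. ideal J R \<Longrightarrow> ideal (ideal_list_prod R Js) R"
  by (induct Js) (auto intro: oneideal ideal_prod_is_ideal)

lemma (in cring) ideal_list_prod_append:
  "\<lbrakk>\<forall>J\<in>set Js. ideal J R; \<forall>K\<in>set Ks. ideal K R\<rbrakk> \<Longrightarrow>
    ideal_list_prod R (Js @ Ks) = ideal_list_prod R Js \<cdot> ideal_list_prod R Ks"
proof (induct Js)
  case Nil
  then show ?case
    by (simp add: ideal_list_prod_is_ideal carrier_ideal_prod)
next
  case (Cons J Js)
  then show ?case by (simp add: ideal_list_prod_is_ideal ideal_prod_assoc)
qed

lemma (in cring) ideal_list_prod_subset_factor:
  assumes "\<forall>J\<in>set Js. ideal J R" "J \<in> set Js"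
  shows "ideal_list_prod R Js \<subseteq> J"
  using assms
proof (induct Js)
  case (Cons K Js)
  then have "ideal_list_prod R (K # Js) \<subseteq> K \<inter> ideal_list_prod R Js"
    using ideal_prod_inter[of K "ideal_list_prod R Js"] by (simp add: ideal_list_prod_is_ideal)
  with Cons show ?case by auto
qed simp

lemma (in cring) primeideal_contains_factor:
  assumes "primeideal P R" "\<forall>J\<in>set Js. ideal J R" "ideal_list_prod R Js \<subseteq> P"
  shows "\<exists>J\<in>set Js. J \<subseteq> P"
  using assms(2,3)
proof (induct Js)
  case Nil
  have "ideal P R" using assms(1) by (rule primeideal.axioms)
  with Nil primeideal.I_notcarr[OF assms(1)] ideal.Icarr[of P R] show ?case by auto
next
  case (Cons K Js)
  then show ?case
    using primeideal_divides_ideal_prod[OF assms(1), of K "ideal_list_prod R Js"]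
    by (auto simp: ideal_list_prod_is_ideal)
qed

lemma (in cring) ideal_list_prod_remove_factor:
  assumes "\<forall>J\<in>set Js. ideal J R" "J \<in> set Js"
  shows "\<exists>K. ideal K R \<and> ideal_list_prod R Js = J \<cdot> K"
  using assms
proof (induct Js)
  case (Cons L Js)
  note id = ideal_list_prod_is_ideal[of Js]
  show ?case
  proof (cases "J = L")
    case True
    then show ?thesis using Cons id by auto
  next
    case False
    then obtain K where K: "ideal K R" "ideal_list_prod R Js = J \<cdot> K" using Cons by auto
    have "ideal L R" "ideal J R" using Cons by auto
    then have "L \<cdot> (J \<cdot> K) = J \<cdot> (L \<cdot> K)"
      using K by (metis ideal_prod_assoc ideal_prod_commute)
    then show ?thesis using K \<open>ideal L R\<close> by (auto intro: ideal_prod_is_ideal)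
  qed
qed simp

section \<open>Adjoining one generator to an ideal\<close>

lemma (in cring) mem_add_cgenideal:
  "x \<in> I <+>\<^bsub>R\<^esub> PIdl b \<longleftrightarrow> (\<exists>p\<in>I. \<exists>r\<in>carrier R. x = p \<oplus> r \<otimes> b)"
  by (auto simp: set_add_def' cgenideal_def)

lemma (in cring) ideal_add_cgenideal:
  assumes "ideal I R" "b \<in> carrier R"
  shows "ideal (I <+>\<^bsub>R\<^esub> PIdl b) R" "I \<subseteq> I <+>\<^bsub>R\<^esub> PIdl b" "b \<in> I <+>\<^bsub>R\<^esub> PIdl b"
proof -
  interpret I: ideal I R by fact
  show "ideal (I <+>\<^bsub>R\<^esub> PIdl b) R" by (intro add_ideals cgenideal_ideal assms)
  have "x \<oplus> \<zero> \<otimes> b \<in> I <+>\<^bsub>R\<^esub> PIdl b" if "x \<in> I" for x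
    unfolding mem_add_cgenideal using that by blast
  then show "I \<subseteq> I <+>\<^bsub>R\<^esub> PIdl b" using assms I.Icarr by auto
  have "\<zero> \<oplus> \<one> \<otimes> b \<in> I <+>\<^bsub>R\<^esub> PIdl b"
    unfolding mem_add_cgenideal using I.zero_closed by blast
  then show "b \<in> I <+>\<^bsub>R\<^esub> PIdl b" using assms by auto
qed

lemma (in cring) add_cgenideal_leI:
  assumes "ideal K R" "I \<subseteq> K" "b \<in> K"
  shows "I <+>\<^bsub>R\<^esub> PIdl b \<subseteq> K"
proof -
  interpret K: ideal K R by fact
  show ?thesis using assms by (auto simp: mem_add_cgenideal intro!: K.a_closed K.I_l_closed)
qed

lemma (in cring) ideal_prod_cgenideal:
  assumes "ideal I R" "b \<in> carrier R" "x \<in> I \<cdot> (PIdl b)"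
  shows "\<exists>i\<in>I. x = i \<otimes> b"
  using assms(3)
proof induct
  interpret I: ideal I R by fact
  {
    case (prod i j)
    then obtain r where r: "r \<in> carrier R" "j = r \<otimes> b" by (auto simp: cgenideal_def)
    have "i \<otimes> j = (i \<otimes> r) \<otimes> b" using r prod I.Icarr assms by (simp add: m_assoc)
    moreover have "i \<otimes> r \<in> I" using prod r by (simp add: I.I_r_closed)
    ultimately show ?case by blast
  next
    case (sum s t)
    then obtain i j where "i \<in> I" "j \<in> I" "s = i \<otimes> b" "t = j \<otimes> b" by auto
    then have "s \<oplus> t = (i \<oplus> j) \<otimes> b" "i \<oplus> j \<in> I"
      using I.Icarr assms by (auto simp: l_distr)
    then show ?case by blast
  }
qed

lemma (in cring) Idl_insert_subset:
  assumes "T \<subseteq> carrier R" "a \<in> carrier R"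
  shows "Idl (insert a T) \<subseteq> Idl T <+>\<^bsub>R\<^esub> PIdl a"
  using ideal_add_cgenideal[OF genideal_ideal[OF assms(1)] assms(2)] genideal_self[OF assms(1)]
  by (intro genideal_minimal) auto

section \<open>Saturation at a prime ideal\<close>

text \<open>
  For a prime \<open>M\<close> this is the contraction to \<open>R\<close> of the extension of \<open>I\<close> to the local ring at \<open>M\<close>.
  Inclusions between ideals of that local ring are thus expressed by \<open>I \<subseteq> saturation M J\<close>,
  without constructing a ring of fractions.
\<close>

definition (in cring) saturation :: "'a set \<Rightarrow> 'a set \<Rightarrow> 'a set" where
  "saturation M I = {x \<in> carrier R. \<exists>s \<in> carrier R - M. s \<otimes> x \<in> I}"

lemma (in cring) saturationI:
  "\<lbrakk>x \<in> carrier R; s \<in> carrier R; s \<notin> M; s \<otimes> x \<in> I\<rbrakk> \<Longrightarrow> x \<in> saturation M I"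
  by (auto simp: saturation_def)

lemma (in cring) saturationE:
  assumes "x \<in> saturation M I"
  obtains s where "x \<in> carrier R" "s \<in> carrier R" "s \<notin> M" "s \<otimes> x \<in> I"
  using assms by (auto simp: saturation_def)

lemma (in cring) saturation_mono: "I \<subseteq> J \<Longrightarrow> saturation M I \<subseteq> saturation M J"
  by (auto simp: saturation_def)

lemma (in cring) prime_one_notin: "primeideal M R \<Longrightarrow> \<one> \<notin> M"
  using ideal.one_imp_carrier[of M R] primeideal.I_notcarr[of M R] primeideal.axioms(1)[of M R] by auto

lemma (in cring) prime_mult_notin:
  "\<lbrakk>primeideal M R; s \<in> carrier R; t \<in> carrier R; s \<notin> M; t \<notin> M\<rbrakk> \<Longrightarrow> s \<otimes> t \<notin> M"
  using primeideal.I_prime[of M R s t] by auto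

lemma (in cring) saturation_ideal:
  assumes "primeideal M R" "ideal I R"
  shows "ideal (saturation M I) R"
proof (rule idealI)
  interpret M: primeideal M R by fact
  interpret I: ideal I R by fact
  show "ring R" by (rule ring_axioms)
  have sub: "x \<in> I \<Longrightarrow> x \<in> saturation M I" for x
    using prime_one_notin[OF assms(1)] I.Icarr by (intro saturationI[of _ \<one>]) auto
  have mul: "a \<otimes> x \<in> saturation M I" if x: "x \<in> saturation M I" and a: "a \<in> carrier R" for a x
  proof -
    from x obtain s where s: "x \<in> carrier R" "s \<in> carrier R" "s \<notin> M" "s \<otimes> x \<in> I"
      by (rule saturationE)
    have "s \<otimes> (a \<otimes> x) = a \<otimes> (s \<otimes> x)" using s a by (simp add: m_lcomm)
    also have "\<dots> \<in> I" using s a by (simp add: I.I_l_closed)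
    finally show ?thesis using s a by (intro saturationI[of _ s]) auto
  qed
  show "subgroup (saturation M I) (add_monoid R)"
  proof (rule add.subgroupI)
    show "saturation M I \<subseteq> carrier R" by (auto simp: saturation_def)
    show "saturation M I \<noteq> {}" using sub[OF I.zero_closed] by auto
    fix x assume x: "x \<in> saturation M I"
    from x have "(\<ominus> \<one>) \<otimes> x \<in> saturation M I" by (intro mul) auto
    moreover have xc: "x \<in> carrier R" using x by (simp add: saturation_def)
    ultimately show "\<ominus> x \<in> saturation M I" by (simp add: l_minus)
    fix y assume "y \<in> saturation M I"
    then obtain t where t: "y \<in> carrier R" "t \<in> carrier R" "t \<notin> M" "t \<otimes> y \<in> I"
      by (rule saturationE)
    from x obtain s where s: "x \<in> carrier R" "s \<in> carrier R" "s \<notin> M" "s \<otimes> x \<in> I"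
      by (rule saturationE)
    have "(s \<otimes> t) \<otimes> (x \<oplus> y) = t \<otimes> (s \<otimes> x) \<oplus> s \<otimes> (t \<otimes> y)" using s t by algebra
    also have "\<dots> \<in> I" using s t by (simp add: I.I_l_closed)
    finally show "x \<oplus> y \<in> saturation M I"
      using s t prime_mult_notin[OF assms(1), of s t] by (intro saturationI[of _ "s \<otimes> t"]) auto
  qed
  fix x a assume "x \<in> saturation M I" "a \<in> carrier R"
  moreover from this have "x \<in> carrier R" by (simp add: saturation_def)
  ultimately show "a \<otimes> x \<in> saturation M I" "x \<otimes> a \<in> saturation M I"
    using mul[of x a] m_comm[of x a] by simp_all
qed

lemma (in cring) saturation_idem:
  assumes "primeideal M R" "ideal I R"
  shows "saturation M (saturation M I) \<subseteq> saturation M I"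
proof
  fix x assume "x \<in> saturation M (saturation M I)"
  then obtain s where s: "x \<in> carrier R" "s \<in> carrier R" "s \<notin> M" "s \<otimes> x \<in> saturation M I"
    by (rule saturationE)
  from s(4) obtain t where t: "t \<in> carrier R" "t \<notin> M" "t \<otimes> (s \<otimes> x) \<in> I"
    by (rule saturationE)
  show "x \<in> saturation M I"
    using s t prime_mult_notin[OF assms(1), of t s]
    by (intro saturationI[of _ "t \<otimes> s"]) (auto simp: m_assoc)
qed

lemma (in cring) saturation_prod:
  assumes "primeideal M R" "ideal I R" "ideal J R"
  shows "saturation M I \<cdot> saturation M J \<subseteq> saturation M (I \<cdot> J)"
proof (rule ideal_prod_leI)
  show "ideal (saturation M (I \<cdot> J)) R"
    by (intro saturation_ideal ideal_prod_is_ideal assms)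
  fix x y assume "x \<in> saturation M I" "y \<in> saturation M J"
  then obtain s t where s: "x \<in> carrier R" "s \<in> carrier R" "s \<notin> M" "s \<otimes> x \<in> I"
    and t: "y \<in> carrier R" "t \<in> carrier R" "t \<notin> M" "t \<otimes> y \<in> J"
    by (metis saturationE)
  have "(s \<otimes> t) \<otimes> (x \<otimes> y) = (s \<otimes> x) \<otimes> (t \<otimes> y)" using s t by algebra
  also have "\<dots> \<in> I \<cdot> J" using s t by (intro ideal_prod.prod)
  finally show "x \<otimes> y \<in> saturation M (I \<cdot> J)"
    using s t prime_mult_notin[OF assms(1), of s t] by (intro saturationI[of _ "s \<otimes> t"]) auto
qed

lemma (in cring) saturation_carrier:
  assumes "ideal J R" "\<not> J \<subseteq> M"
  shows "saturation M J = carrier R"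
proof -
  interpret J: ideal J R by fact
  from assms(2) obtain s where "s \<in> J" "s \<notin> M" by blast
  then show ?thesis
    by (auto simp: saturation_def intro!: bexI[of _ s] J.I_r_closed dest: J.Icarr)
qed

section \<open>Powers of a prime, Nakayama, and local generators\<close>

abbreviation (in cring) ideal_pow :: "'a set \<Rightarrow> nat \<Rightarrow> 'a set" where
  "ideal_pow M n \<equiv> ideal_list_prod R (replicate n M)"

text \<open>
  After localization at \<open>M\<close>, each factor either coincides with \<open>M\<close> (when it lies in \<open>M\<close>) or
  becomes the unit ideal (when it does not). So the whole product becomes a power of \<open>M\<close>, the exponent
  counting the factors of the first kind.
\<close>

lemma (in cring) prod_saturated_eq_power:
  assumes M: "primeideal M R"
    and Js: "\<forall>J\<in>set Js. ideal J R \<and> M \<subseteq> saturation M J"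
  shows "\<exists>n. ideal_list_prod R Js \<subseteq> ideal_pow M n
           \<and> ideal_pow M n \<subseteq> saturation M (ideal_list_prod R Js)"
  using Js
proof (induct Js)
  case Nil
  have "carrier R \<subseteq> saturation M (carrier R)"
    using prime_one_notin[OF M] by (auto intro: saturationI[of _ \<one>])
  then show ?case by (auto intro!: exI[of _ 0])
next
  case (Cons J Js)
  have Mi: "ideal M R" using M by (rule primeideal.axioms)
  from Cons obtain n where n: "ideal_list_prod R Js \<subseteq> ideal_pow M n"
      "ideal_pow M n \<subseteq> saturation M (ideal_list_prod R Js)" by auto
  have J: "ideal J R" "M \<subseteq> saturation M J" using Cons by auto
  have I: "ideal (ideal_list_prod R Js) R" using Cons by (auto intro: ideal_list_prod_is_ideal)
  have Mn: "ideal (ideal_pow M n) R" by (rule ideal_list_prod_is_ideal) (use Mi in auto)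
  note sp = saturation_prod[OF M J(1) I]
  show ?case
  proof (cases "J \<subseteq> M")
    case True
    have "M \<cdot> ideal_pow M n \<subseteq> saturation M (J \<cdot> ideal_list_prod R Js)"
      using ideal_prod_mono[OF J(2) n(2)] sp by blast
    then show ?thesis using ideal_prod_mono[OF True n(1)] by (intro exI[of _ "Suc n"]) simp
  next
    case False
    have "carrier R \<cdot> ideal_pow M n \<subseteq> saturation M (J \<cdot> ideal_list_prod R Js)"
      using ideal_prod_mono[OF _ n(2), of "carrier R" "saturation M J"] sp
        saturation_carrier[OF J(1) False] by blast
    then have "ideal_pow M n \<subseteq> saturation M (J \<cdot> ideal_list_prod R Js)"
      by (simp add: carrier_ideal_prod Mn)
    moreover have "J \<cdot> ideal_list_prod R Js \<subseteq> ideal_pow M n"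
      using ideal_prod_inter[OF J(1) I] n by blast
    ultimately show ?thesis by auto
  qed
qed

text \<open>
  Nakayama's lemma in the local ring at \<open>M\<close>, by removing generators one at a time: if \<open>P\<close> is locally
  generated by \<open>T\<close> and \<open>a\<close>, then \<open>a \<in> M P\<close> locally, so \<open>(s - m) a \<in> Idl T\<close> with \<open>s \<notin> M\<close> and
  \<open>m \<in> M\<close>. As \<open>s - m\<close> is a local unit, \<open>T\<close> alone generates \<open>P\<close> locally.
\<close>

lemma (in cring) Nakayama_saturation:
  assumes M: "primeideal M R" and P: "ideal P R"
    and fg: "finite S" "S \<subseteq> carrier R" "P = Idl S"
    and PMP: "P \<subseteq> saturation M (M \<cdot> P)"
  shows "P \<subseteq> saturation M {\<zero>}"
proof -
  interpret M: primeideal M R by fact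
  interpret P: ideal P R by fact
  have Mi: "ideal M R" using M by (rule primeideal.axioms)
  have drop: "P \<subseteq> saturation M (Idl T) \<Longrightarrow> P \<subseteq> saturation M {\<zero>}"
    if "finite T" "T \<subseteq> P" for T
    using that
  proof (induct T)
    case empty
    have "Idl {} \<subseteq> {\<zero>}" by (intro genideal_minimal zeroideal) auto
    then show ?case using empty(1) saturation_mono[of "Idl {}" "{\<zero>}" M] by simp
  next
    case (insert a T)
    have T: "T \<subseteq> carrier R" and a: "a \<in> P" "a \<in> carrier R" using insert(5) P.a_subset by auto
    interpret IT: ideal "Idl T" R using T by (rule genideal_ideal)
    let ?L = "saturation M (Idl T)"
    have IiT: "ideal (Idl (insert a T)) R" using T a by (intro genideal_ideal) auto
    have MP: "M \<cdot> P \<subseteq> saturation M (M \<cdot> (Idl (insert a T)))"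
    proof (rule ideal_prod_leI)
      show "ideal (saturation M (M \<cdot> (Idl (insert a T)))) R"
        by (intro saturation_ideal M ideal_prod_is_ideal Mi IiT)
      fix m x assume mx: "m \<in> M" "x \<in> P"
      then have "x \<in> saturation M (Idl (insert a T))" using subsetD[OF insert(4)] by simp
      then obtain s where s: "x \<in> carrier R" "s \<in> carrier R" "s \<notin> M" "s \<otimes> x \<in> Idl (insert a T)"
        by (rule saturationE)
      have m: "m \<in> carrier R" using mx by auto
      have "s \<otimes> (m \<otimes> x) = m \<otimes> (s \<otimes> x)" using s m by algebra
      also have "\<dots> \<in> M \<cdot> (Idl (insert a T))" using mx s by (intro ideal_prod.prod)
      finally show "m \<otimes> x \<in> saturation M (M \<cdot> (Idl (insert a T)))"
        using s m by (intro saturationI[of _ s]) auto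
    qed
    note PMP
    also note saturation_mono[OF MP]
    also note saturation_idem[OF M ideal_prod_is_ideal[OF Mi IiT]]
    finally have "a \<in> saturation M (M \<cdot> (Idl (insert a T)))" using a(1) by (rule subsetD)
    then obtain s where s: "s \<in> carrier R" "s \<notin> M" "s \<otimes> a \<in> M \<cdot> (Idl (insert a T))"
      by (rule saturationE)
    have "M \<cdot> (Idl (insert a T)) \<subseteq> Idl T <+>\<^bsub>R\<^esub> (M \<cdot> (PIdl a))"
    proof -
      have "M \<cdot> (Idl (insert a T)) \<subseteq> M \<cdot> (Idl T <+>\<^bsub>R\<^esub> PIdl a)"
        using Idl_insert_subset[OF T a(2)] by (intro ideal_prod_mono) auto
      also have "\<dots> = M \<cdot> (Idl T) <+>\<^bsub>R\<^esub> M \<cdot> (PIdl a)"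
        by (intro ideal_prod_distr Mi cgenideal_ideal a) (rule IT.is_ideal)
      also have "\<dots> \<subseteq> Idl T <+>\<^bsub>R\<^esub> M \<cdot> (PIdl a)"
        using ideal_prod_inter[OF Mi IT.is_ideal] by (auto simp: set_add_def')
      finally show ?thesis .
    qed
    with s obtain u v where uv: "u \<in> Idl T" "v \<in> M \<cdot> (PIdl a)" "s \<otimes> a = u \<oplus> v"
      by (auto simp: set_add_def')
    from ideal_prod_cgenideal[OF Mi a(2) uv(2)] obtain m where m: "m \<in> M" "v = m \<otimes> a" by blast
    have mc: "m \<in> carrier R" "u \<in> carrier R" using m uv IT.Icarr by auto
    have "(s \<ominus> m) \<otimes> a = (u \<oplus> m \<otimes> a) \<ominus> m \<otimes> a"
      using uv m mc s a by (simp add: l_distr a_minus_def l_minus)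
    also have "\<dots> = u" using mc a by algebra
    finally have "(s \<ominus> m) \<otimes> a \<in> Idl T" using uv by simp
    moreover have "s \<ominus> m \<notin> M"
    proof
      assume "s \<ominus> m \<in> M"
      then have "(s \<ominus> m) \<oplus> m \<in> M" using m by auto
      moreover have "(s \<ominus> m) \<oplus> m = s" using s mc by algebra
      ultimately show False using s by simp
    qed
    ultimately have aL: "a \<in> ?L" using s mc a by (intro saturationI[of _ "s \<ominus> m"]) auto
    have L: "ideal ?L R" by (intro saturation_ideal M) (rule IT.is_ideal)
    have "T \<subseteq> ?L"
    proof
      fix x assume "x \<in> T"
      then show "x \<in> ?L" using genideal_self[OF T] T prime_one_notin[OF M]
        by (intro saturationI[of _ \<one>]) auto
    qed
    then have "Idl (insert a T) \<subseteq> ?L" using aL by (intro genideal_minimal L) auto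
    from subset_trans[OF insert(4) subset_trans[OF saturation_mono[OF this] saturation_idem[OF M IT.is_ideal]]]
    have "P \<subseteq> ?L" .
    then show ?case using insert(3,5) by simp
  qed
  have "P \<subseteq> saturation M P"
  proof
    fix x assume "x \<in> P"
    then show "x \<in> saturation M P"
      using prime_one_notin[OF M] P.Icarr[of x] by (intro saturationI[of _ \<one>]) simp_all
  qed
  then have "P \<subseteq> saturation M (Idl S)" using fg(3) by simp
  moreover have "S \<subseteq> P" using genideal_self[OF fg(2)] fg(3) by simp
  ultimately show ?thesis using drop fg(1) by simp
qed

text \<open>
  Modulo \<open>P\<close> and locally at \<open>M\<close> the hypotheses say that \<open>M\<^sup>n\<close> is generated by the nonzero element \<open>b\<close>
  of a domain. Then \<open>M\<close> is invertible, and an invertible ideal of a local domain is principal.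
  Concretely, \<open>M\<^sup>n = M M\<^sup>n\<^sup>-\<^sup>1\<close> is not contained in \<open>b M\<close>, so some product \<open>m y\<close> of the two
  factors is \<open>b\<close> times a local unit. For \<open>x \<in> M\<close> the element \<open>x y\<close> is a multiple of \<open>b\<close>, hence of
  \<open>m y\<close>, and cancelling \<open>y\<close> makes \<open>x\<close> a multiple of \<open>m\<close>.
\<close>

lemma (in cring) locally_principal_of_power:
  assumes M: "primeideal M R" and P: "primeideal P R" and PM: "P \<subseteq> M"
    and b: "b \<in> M" "b \<notin> P"
    and le: "P <+>\<^bsub>R\<^esub> PIdl b \<subseteq> ideal_pow M n"
    and ge: "ideal_pow M n \<subseteq> saturation M (P <+>\<^bsub>R\<^esub> PIdl b)"
  shows "\<exists>c\<in>M. M \<subseteq> saturation M (P <+>\<^bsub>R\<^esub> PIdl c)"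
proof -
  interpret M: primeideal M R by fact
  interpret P: primeideal P R by fact
  have Mi: "ideal M R" and Pi: "ideal P R" by (rule M.is_ideal P.is_ideal)+
  have bc: "b \<in> carrier R" using b by auto
  have IM: "P <+>\<^bsub>R\<^esub> PIdl b \<subseteq> M" using add_cgenideal_leI[OF Mi PM b(1)] .
  have "n \<noteq> 0"
  proof
    assume "n = 0"
    then have "\<one> \<in> saturation M (P <+>\<^bsub>R\<^esub> PIdl b)" using ge by auto
    then obtain s where "s \<in> carrier R" "s \<notin> M" "s \<otimes> \<one> \<in> P <+>\<^bsub>R\<^esub> PIdl b" by (rule saturationE)
    then show False using IM by auto
  qed
  then obtain k where n: "n = Suc k" by (cases n) auto
  have Mk: "ideal (ideal_pow M k) R" by (rule ideal_list_prod_is_ideal) (use Mi in auto)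
  \<comment> \<open>The saturation of \<open>P + b M\<close>: the elements that are locally \<open>b\<close> times a non-unit.\<close>
  define N where "N = saturation M (P <+>\<^bsub>R\<^esub> M \<cdot> (PIdl b))"
  have MbI: "ideal (M \<cdot> (PIdl b)) R" by (intro ideal_prod_is_ideal Mi cgenideal_ideal bc)
  have N: "ideal N R" unfolding N_def by (intro saturation_ideal M add_ideals Pi MbI)
  have "\<exists>m\<in>M. \<exists>y\<in>ideal_pow M k. m \<otimes> y \<notin> N"
  proof (rule ccontr)
    assume "\<not> ?thesis"
    then have "M \<cdot> ideal_pow M k \<subseteq> N" using N by (intro ideal_prod_leI) auto
    then have "b \<in> N" using le n ideal_add_cgenideal(3)[OF Pi bc] by auto
    then obtain s where s: "s \<in> carrier R" "s \<notin> M" "s \<otimes> b \<in> P <+>\<^bsub>R\<^esub> M \<cdot> (PIdl b)"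
      unfolding N_def by (rule saturationE)
    then obtain p v where pv: "p \<in> P" "v \<in> M \<cdot> (PIdl b)" "s \<otimes> b = p \<oplus> v"
      by (auto simp: set_add_def')
    from ideal_prod_cgenideal[OF Mi bc pv(2)] obtain m where m: "m \<in> M" "v = m \<otimes> b" by blast
    have c: "p \<in> carrier R" "m \<in> carrier R" using pv m by auto
    have "(s \<ominus> m) \<otimes> b = (p \<oplus> m \<otimes> b) \<ominus> m \<otimes> b"
      using pv m c s bc by (simp add: l_distr a_minus_def l_minus)
    also have "\<dots> = p" using c bc by algebra
    finally have "(s \<ominus> m) \<otimes> b \<in> P" using pv by simp
    then have "s \<ominus> m \<in> P" using P.I_prime[of "s \<ominus> m" b] s c bc b by auto
    then have "(s \<ominus> m) \<oplus> m \<in> M" using PM m by (intro M.a_closed) auto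
    moreover have "(s \<ominus> m) \<oplus> m = s" using s c by algebra
    ultimately show False using s by simp
  qed
  \<comment> \<open>This \<open>m\<close> will be the local generator.\<close>
  then obtain m y where m: "m \<in> M" and y: "y \<in> ideal_pow M k" and my: "m \<otimes> y \<notin> N" by blast
  have mc: "m \<in> carrier R" and yc: "y \<in> carrier R" using m y ideal.Icarr[OF Mk] by auto
  have local: "\<exists>s p t. s \<in> carrier R \<and> s \<notin> M \<and> p \<in> P \<and> t \<in> carrier R \<and> s \<otimes> (x \<otimes> y) = p \<oplus> t \<otimes> b"
    if "x \<in> M" for x
  proof -
    have "x \<otimes> y \<in> saturation M (P <+>\<^bsub>R\<^esub> PIdl b)"
      using ge that y unfolding n by (auto intro: ideal_prod.prod)
    then obtain s where "s \<in> carrier R" "s \<notin> M" "s \<otimes> (x \<otimes> y) \<in> P <+>\<^bsub>R\<^esub> PIdl b"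
      by (rule saturationE)
    then show ?thesis unfolding mem_add_cgenideal by blast
  qed
  from local[OF m] obtain s p t where s: "s \<in> carrier R" "s \<notin> M" and p: "p \<in> P"
    and t: "t \<in> carrier R" and eq: "s \<otimes> (m \<otimes> y) = p \<oplus> t \<otimes> b" by blast
  have pc: "p \<in> carrier R" using p by auto
  have tM: "t \<notin> M"
  proof
    assume "t \<in> M"
    moreover have "b \<in> PIdl b" using bc by (rule cgenideal_self)
    ultimately have "s \<otimes> (m \<otimes> y) \<in> P <+>\<^bsub>R\<^esub> M \<cdot> (PIdl b)"
      unfolding eq set_add_def' using p by (blast intro: ideal_prod.prod)
    then have "m \<otimes> y \<in> N" unfolding N_def using s mc yc by (intro saturationI[of _ s]) auto
    with my show False by simp
  qed
  have yP: "y \<notin> P"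
  proof
    assume "y \<in> P"
    then have "s \<otimes> (m \<otimes> y) \<ominus> p \<in> P" using s mc p
      unfolding a_minus_def by (intro P.a_closed P.I_l_closed P.a_inv_closed) auto
    moreover have "s \<otimes> (m \<otimes> y) \<ominus> p = t \<otimes> b" unfolding eq using pc t bc by algebra
    ultimately have "t \<in> P" using P.I_prime[of t b] t bc b by auto
    then show False using tM PM by auto
  qed
  have "M \<subseteq> saturation M (P <+>\<^bsub>R\<^esub> PIdl m)"
  proof
    fix x assume x: "x \<in> M"
    then have xc: "x \<in> carrier R" by auto
    from local[OF x] obtain r q u where r: "r \<in> carrier R" "r \<notin> M" and q: "q \<in> P"
      and u: "u \<in> carrier R" and eq2: "r \<otimes> (x \<otimes> y) = q \<oplus> u \<otimes> b" by blast
    have qc: "q \<in> carrier R" using q by auto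
    let ?d = "(t \<otimes> r) \<otimes> x \<ominus> (u \<otimes> s) \<otimes> m"
    have dc: "?d \<in> carrier R" using t r xc u s mc by auto
    have "y \<otimes> ?d = t \<otimes> (r \<otimes> (x \<otimes> y)) \<ominus> u \<otimes> (s \<otimes> (m \<otimes> y))"
      using yc t r xc u s mc by algebra
    also have "\<dots> = t \<otimes> q \<ominus> u \<otimes> p"
      unfolding eq eq2 using t qc u pc bc by algebra
    also have "\<dots> \<in> P" using t q u p unfolding a_minus_def
      by (intro P.a_closed P.I_l_closed P.a_inv_closed)
    finally have d: "?d \<in> P" using P.I_prime[OF yc dc] yP by auto
    have "(t \<otimes> r) \<otimes> x = ?d \<oplus> (u \<otimes> s) \<otimes> m" using t r xc u s mc by algebra
    then have "(t \<otimes> r) \<otimes> x \<in> P <+>\<^bsub>R\<^esub> PIdl m"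
      unfolding mem_add_cgenideal using d u s by blast
    then show "x \<in> saturation M (P <+>\<^bsub>R\<^esub> PIdl m)"
      using xc t r prime_mult_notin[OF M, of t r] tM by (intro saturationI[of _ "t \<otimes> r"]) auto
  qed
  then show ?thesis using m by blast
qed

section \<open>Radical ideals and minimal primes\<close>

lemma (in cring) regular_ideal_superset:
  assumes "regular_ideal I R" "ideal J R" "I \<subseteq> J"
  shows "regular_ideal J R"
  using assms by (auto simp: regular_ideal_def)

lemma (in cring) radical_ideal_memI:
  assumes "radical_ideal J R" "x \<in> carrier R" "x [^] (n::nat) \<in> J"
  shows "x \<in> J"
proof (cases n)
  case 0
  interpret J: ideal J R using assms(1) by (simp add: radical_ideal_def)
  have "\<one> \<in> J" using assms(3) 0 by simp
  then show ?thesis using J.one_imp_carrier assms(2) by simp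
next
  case (Suc k)
  then have "n > 0" by simp
  then have "x \<in> radical_of R J" unfolding radical_of_def using assms(2,3) by blast
  then show ?thesis using assms(1) by (simp add: radical_ideal_def)
qed

lemma (in cring) prime_imp_radical:
  assumes "primeideal P R"
  shows "radical_ideal P R"
proof -
  interpret P: primeideal P R by fact
  have pow: "x \<in> P" if x: "x \<in> carrier R" and "x [^] n \<in> P" for x and n :: nat
    using that(2)
  proof (induct n)
    case 0
    then show ?case using prime_one_notin[OF assms] by simp
  next
    case (Suc n)
    then have "x [^] n \<in> P \<or> x \<in> P" using x by (intro P.I_prime) simp_all
    with Suc.hyps show ?case by blast
  qed
  have "P \<subseteq> radical_of R P"
  proof
    fix x assume x: "x \<in> P"
    then have "x \<in> carrier R" "x [^] (1::nat) \<in> P" using P.Icarr[OF x] by simp_all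
    then show "x \<in> radical_of R P" unfolding radical_of_def using zero_less_one by blast
  qed
  moreover have "radical_of R P \<subseteq> P" unfolding radical_of_def using pow by blast
  ultimately show ?thesis using P.is_ideal by (simp add: radical_ideal_def)
qed

text \<open>
  Localizing a radical ideal gives a radical ideal: from \<open>s x\<^sup>n \<in> J\<close> one gets a power of \<open>s x\<close> in \<open>J\<close>.
\<close>

lemma (in cring) radical_saturation_powD:
  assumes J: "radical_ideal J R" and x: "x \<in> carrier R" "x [^] (n::nat) \<in> saturation M J"
  shows "x \<in> saturation M J"
proof -
  interpret J: ideal J R using J by (simp add: radical_ideal_def)
  from x(2) obtain s where s: "s \<in> carrier R" "s \<notin> M" "s \<otimes> x [^] n \<in> J"
    by (rule saturationE)
  have "(s \<otimes> x) [^] Suc n = (s [^] n \<otimes> x) \<otimes> (s \<otimes> x [^] n)"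
  proof -
    have "(s \<otimes> x) [^] Suc n = (s [^] n \<otimes> x [^] n) \<otimes> (s \<otimes> x)"
      using s(1) x(1) by (simp add: nat_pow_distrib)
    moreover have "s [^] n \<in> carrier R" "x [^] n \<in> carrier R" using s(1) x(1) by simp_all
    ultimately show ?thesis using s(1) x(1) by (simp add: m_ac)
  qed
  also have "\<dots> \<in> J" using s(1) x(1) by (intro J.I_l_closed[OF s(3)]) simp
  finally have pow: "(s \<otimes> x) [^] Suc n \<in> J" .
  have "s \<otimes> x \<in> J" using s(1) x(1) by (intro radical_ideal_memI[OF J _ pow]) simp
  then show ?thesis using s x(1) by (intro saturationI[of _ s]) auto
qed

text \<open>
  This condition replaces a decomposition into minimal primes. In a Dedekind ring it is part of the
  factorization axiom, and in a regular-Noetherian ring it comes from the maximal condition; in both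
  cases it provides primes minimal over a regular ideal.
\<close>

definition (in cring) has_prime_product :: "'a set \<Rightarrow> bool" where
  "has_prime_product I \<longleftrightarrow>
     (\<exists>Qs. (\<forall>Q\<in>set Qs. primeideal Q R \<and> I \<subseteq> Q) \<and> ideal_list_prod R Qs \<subseteq> I)"

text \<open>
  A factor that is not contained in \<open>M\<close> contains a local unit, and each factor equal to \<open>M\<close> costs one
  more power of \<open>x\<close>.
\<close>

lemma (in cring) pow_mem_saturation_prod:
  assumes M: "primeideal M R" and x: "x \<in> M"
    and Qs: "\<forall>Q\<in>set Qs. ideal Q R \<and> (Q = M \<or> \<not> Q \<subseteq> M)"
  shows "\<exists>n::nat. x [^] n \<in> saturation M (ideal_list_prod R Qs)"
proof -
  interpret M: primeideal M R by fact
  have xc: "x \<in> carrier R" using x by auto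
  show ?thesis
    using Qs
  proof (induct Qs)
    case Nil
    have "x [^] (0::nat) \<in> saturation M (carrier R)"
      using prime_one_notin[OF M] by (intro saturationI[of _ \<one>]) auto
    then show ?case unfolding ideal_list_prod_Nil by (rule exI)
  next
    case (Cons Q Qs)
    from Cons(1) Cons(2) have "\<exists>n::nat. x [^] n \<in> saturation M (ideal_list_prod R Qs)" by simp
    then obtain n :: nat where "x [^] n \<in> saturation M (ideal_list_prod R Qs)" ..
    then obtain s where s: "s \<in> carrier R" "s \<notin> M" "s \<otimes> x [^] n \<in> ideal_list_prod R Qs"
      by (rule saturationE)
    show ?case
    proof (cases "Q = M")
      case True
      have "s \<otimes> x [^] Suc n = x \<otimes> (s \<otimes> x [^] n)"
        using s(1) xc by (simp add: m_ac)
      also have "\<dots> \<in> M \<cdot> ideal_list_prod R Qs" using x s by (intro ideal_prod.prod)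
      finally have "x [^] Suc n \<in> saturation M (ideal_list_prod R (Q # Qs))"
        using True s xc by (intro saturationI[of _ s]) simp_all
      then show ?thesis by (rule exI)
    next
      case False
      then have "\<not> Q \<subseteq> M" using Cons(2) by simp
      then obtain q where q: "q \<in> Q" "q \<notin> M" by blast
      have qc: "q \<in> carrier R" using q Cons(2) ideal.Icarr[of Q R q] by simp
      have "(q \<otimes> s) \<otimes> x [^] n = q \<otimes> (s \<otimes> x [^] n)"
        using s(1) xc qc by (simp add: m_assoc)
      also have "\<dots> \<in> Q \<cdot> ideal_list_prod R Qs" using q s by (intro ideal_prod.prod)
      finally have "x [^] n \<in> saturation M (ideal_list_prod R (Q # Qs))"
        using s(1,2) xc q(2) qc prime_mult_notin[OF M, of q s]
        by (intro saturationI[of _ "q \<otimes> s"]) simp_all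
      then show ?thesis by (rule exI)
    qed
  qed
qed

text \<open>
  Any prime that contains \<open>I\<close> contains one of the primes in the product, so \<open>M\<close> can be taken minimal
  among those. The property recorded here is what minimality gives: locally at \<open>M\<close>, the ideal \<open>M\<close> is
  the only proper radical ideal over \<open>I\<close>.
\<close>

lemma (in cring) minimal_prime_exists:
  assumes "has_prime_product I" "ideal I R" "I \<noteq> carrier R"
  shows "\<exists>M. primeideal M R \<and> I \<subseteq> M \<and>
           (\<forall>J. radical_ideal J R \<and> I \<subseteq> J \<longrightarrow> M \<subseteq> saturation M J)"
proof -
  from assms(1) obtain Qs where Qs: "\<forall>Q\<in>set Qs. primeideal Q R \<and> I \<subseteq> Q"
    and prod: "ideal_list_prod R Qs \<subseteq> I" by (auto simp: has_prime_product_def)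
  interpret I: ideal I R by fact
  have "Qs \<noteq> []" using prod assms(3) I.a_subset by auto
  then obtain M where M: "M \<in> set Qs" and min: "\<forall>Q\<in>set Qs. Q \<subseteq> M \<longrightarrow> M = Q"
    using finite_has_minimal[of "set Qs"] by auto
  have Mp: "primeideal M R" and IM: "I \<subseteq> M" using M Qs by auto
  interpret M: primeideal M R by (rule Mp)
  have "\<forall>Q\<in>set Qs. ideal Q R \<and> (Q = M \<or> \<not> Q \<subseteq> M)"
    using Qs min primeideal.axioms(1) by metis
  note pow = pow_mem_saturation_prod[OF Mp _ this]
  have "M \<subseteq> saturation M J" if J: "radical_ideal J R" "I \<subseteq> J" for J
  proof
    fix x assume x: "x \<in> M"
    from pow[OF x] obtain n :: nat where n: "x [^] n \<in> saturation M (ideal_list_prod R Qs)" by blast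
    have "saturation M (ideal_list_prod R Qs) \<subseteq> saturation M J"
      using prod J(2) by (intro saturation_mono) auto
    with n have "x [^] n \<in> saturation M J" by auto
    then show "x \<in> saturation M J" using x by (intro radical_saturation_powD[OF J(1), of x n]) auto
  qed
  then show ?thesis using Mp IM by blast
qed

lemma (in cring) saturation_proper:
  assumes "I \<subseteq> M"
  shows "\<one> \<notin> saturation M I"
proof
  assume "\<one> \<in> saturation M I"
  then obtain s where "s \<in> carrier R" "s \<notin> M" "s \<otimes> \<one> \<in> I" by (rule saturationE)
  then show False using assms by auto
qed

section \<open>Finitely generated regular primes are maximal\<close>

text \<open>
  Suppose \<open>b \<notin> P\<close> generates with \<open>P\<close> a proper ideal, and let \<open>M\<close> be a prime minimal over \<open>P + (b)\<close>.
  All statements that follow are meant locally at \<open>M\<close>.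

  The factorization of \<open>P + (b)\<close> into radical ideals shows that it is a power of \<open>M\<close>; therefore
  \<open>M = P + (c)\<close> for some \<open>c\<close>. A radical ideal over \<open>P + (c\<^sup>2)\<close> contains \<open>c\<close>, so it is \<open>M\<close> or
  the unit ideal, and \<open>P + (c\<^sup>2)\<close> is a power of \<open>M\<close> too. It is neither the unit ideal nor \<open>M\<close>: the
  latter would give \<open>c (s - r c) \<in> P\<close> with \<open>s - r c\<close> a unit. Hence \<open>P \<subseteq> M\<^sup>2 = (P + (c))\<^sup>2 \<subseteq> M P + (c\<^sup>2)\<close>.
  Since \<open>r c\<^sup>2 \<in> P\<close> forces \<open>r \<in> P\<close>, this gives \<open>P = M P\<close>, so \<open>P = 0\<close> by Nakayama's lemma. But a regular
  element remains nonzero under localization.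
\<close>

lemma (in sp_ring) fg_regular_prime_maximal:
  assumes P: "primeideal P R" and reg: "regular_ideal P R"
    and fg: "finite S" "S \<subseteq> carrier R" "P = Idl S"
    and pp: "\<And>I. regular_ideal I R \<Longrightarrow> has_prime_product I"
  shows "maximalideal P R"
proof (rule maximalidealI)
  interpret P: primeideal P R by fact
  show Pi: "ideal P R" by (rule P.is_ideal)
  show "carrier R \<noteq> P" by (rule P.I_notcarr)
  fix L assume L: "ideal L R" "P \<subseteq> L" "L \<subseteq> carrier R"
  show "L = P \<or> L = carrier R"
  proof (rule ccontr)
    assume contra: "\<not> (L = P \<or> L = carrier R)"
    then obtain b where b: "b \<in> L" "b \<notin> P" using L(2) by blast
    have bc: "b \<in> carrier R" using b L(3) by blast
    let ?I = "P <+>\<^bsub>R\<^esub> PIdl b"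
    note I = ideal_add_cgenideal[OF Pi bc]
    have "?I \<subseteq> L" by (rule add_cgenideal_leI[OF L(1,2) b(1)])
    then have "?I \<noteq> carrier R" using contra L(3) by blast
    moreover have Ireg: "regular_ideal ?I R" by (rule regular_ideal_superset[OF reg I(1,2)])
    ultimately obtain M where M: "primeideal M R" "?I \<subseteq> M"
      and Mrad: "\<And>J. radical_ideal J R \<Longrightarrow> ?I \<subseteq> J \<Longrightarrow> M \<subseteq> saturation M J"
      using minimal_prime_exists[OF pp[OF Ireg] I(1)] by blast
    interpret M: primeideal M R by (rule M)
    have Mi: "ideal M R" by (rule M.is_ideal)
    have PM: "P \<subseteq> M" and bM: "b \<in> M" using M(2) I by auto
    obtain Js where Js: "\<forall>J\<in>set Js. radical_ideal J R" "?I = ideal_list_prod R Js"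
      using radical_factorization[OF Ireg] by blast
    have Jid: "\<forall>J\<in>set Js. ideal J R" using Js(1) by (simp add: radical_ideal_def)
    have "\<forall>J\<in>set Js. ideal J R \<and> M \<subseteq> saturation M J"
      using Js(1) Jid Mrad ideal_list_prod_subset_factor[OF Jid] unfolding Js(2) by simp
    from prod_saturated_eq_power[OF M(1) this]
    obtain n where n: "?I \<subseteq> ideal_pow M n" "ideal_pow M n \<subseteq> saturation M ?I"
      unfolding Js(2) by blast
    from locally_principal_of_power[OF M(1) P PM bM b(2) n]
    obtain c where c: "c \<in> M" and cM: "M \<subseteq> saturation M (P <+>\<^bsub>R\<^esub> PIdl c)" by blast
    have cc: "c \<in> carrier R" using c by auto
    have cP: "c \<notin> P"
    proof
      assume "c \<in> P"
      then have "P <+>\<^bsub>R\<^esub> PIdl c \<subseteq> P" by (intro add_cgenideal_leI Pi) auto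
      from saturation_mono[OF this] cM bM have "b \<in> saturation M P" by blast
      then obtain s where "s \<in> carrier R" "s \<notin> M" "s \<otimes> b \<in> P" by (rule saturationE)
      then show False using P.I_prime[of s b] bc b PM by auto
    qed
    let ?Q = "P <+>\<^bsub>R\<^esub> PIdl (c \<otimes> c)"
    have ccc: "c \<otimes> c \<in> carrier R" using cc by simp
    note Q = ideal_add_cgenideal[OF Pi ccc]
    have QM: "?Q \<subseteq> M" using c cc by (intro add_cgenideal_leI Mi PM M.I_l_closed)
    obtain Ks where Ks: "\<forall>K\<in>set Ks. radical_ideal K R" "?Q = ideal_list_prod R Ks"
      using radical_factorization[OF regular_ideal_superset[OF reg Q(1,2)]] by blast
    have Kid: "\<forall>K\<in>set Ks. ideal K R" using Ks(1) by (simp add: radical_ideal_def)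
    have "M \<subseteq> saturation M K" if K: "K \<in> set Ks" for K
    proof
      interpret K: ideal K R using Kid K by simp
      have QK: "?Q \<subseteq> K" unfolding Ks(2) by (rule ideal_list_prod_subset_factor[OF Kid K])
      have ccK: "c \<otimes> c \<in> K" using QK Q(3) by blast
      fix x assume x: "x \<in> M"
      then have "x \<in> saturation M (P <+>\<^bsub>R\<^esub> PIdl c)" using cM by blast
      then obtain s where s: "x \<in> carrier R" "s \<in> carrier R" "s \<notin> M" "s \<otimes> x \<in> P <+>\<^bsub>R\<^esub> PIdl c"
        by (rule saturationE)
      from s(4) obtain p r where pr: "p \<in> P" "r \<in> carrier R" "s \<otimes> x = p \<oplus> r \<otimes> c"
        unfolding mem_add_cgenideal by blast
      have pc: "p \<in> carrier R" using pr by auto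
      have pK: "p \<in> K" using QK Q(2) pr by blast
      have "(s \<otimes> x) [^] (2::nat) = (p \<oplus> r \<otimes> c) \<otimes> (p \<oplus> r \<otimes> c)"
        unfolding pr(3) numeral_2_eq_2 using pc pr(2) cc by simp
      also have "\<dots> = (p \<oplus> r \<otimes> c \<oplus> r \<otimes> c) \<otimes> p \<oplus> (r \<otimes> r) \<otimes> (c \<otimes> c)"
        using pc pr(2) cc by algebra
      also have "\<dots> \<in> K" using pc pr(2) cc pK ccK by (simp add: K.a_closed K.I_l_closed)
      finally have sq: "(s \<otimes> x) [^] (2::nat) \<in> K" .
      have "s \<otimes> x \<in> K" using Ks(1) K s by (intro radical_ideal_memI[OF _ _ sq]) simp_all
      then show "x \<in> saturation M K" using s by (intro saturationI[of _ s]) auto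
    qed
    then have "\<forall>K\<in>set Ks. ideal K R \<and> M \<subseteq> saturation M K" using Kid by blast
    from prod_saturated_eq_power[OF M(1) this]
    obtain k where k: "?Q \<subseteq> ideal_pow M k" "ideal_pow M k \<subseteq> saturation M ?Q"
      unfolding Ks(2) by blast
    have "k \<noteq> 0" using k(2) saturation_proper[OF QM] by (cases k) auto
    moreover have "k \<noteq> 1"
    proof
      assume "k = 1"
      then have "c \<in> saturation M ?Q" using k(2) c by (auto simp: ideal_prod_one Mi)
      then obtain s where s: "s \<in> carrier R" "s \<notin> M" "s \<otimes> c \<in> ?Q" by (rule saturationE)
      from s(3) obtain p r where pr: "p \<in> P" "r \<in> carrier R" "s \<otimes> c = p \<oplus> r \<otimes> (c \<otimes> c)"
        unfolding mem_add_cgenideal by blast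
      have pc: "p \<in> carrier R" using pr by auto
      have "c \<otimes> (s \<ominus> r \<otimes> c) = s \<otimes> c \<ominus> r \<otimes> (c \<otimes> c)" using cc s pr(2) by algebra
      also have "\<dots> = p" unfolding pr(3) using pc pr(2) cc by algebra
      finally have "s \<ominus> r \<otimes> c \<in> P"
        using P.I_prime[of c "s \<ominus> r \<otimes> c"] cc s pr cP by auto
      then have "(s \<ominus> r \<otimes> c) \<oplus> r \<otimes> c \<in> M" using PM c pr(2)
        by (intro M.a_closed M.I_l_closed) auto
      moreover have "(s \<ominus> r \<otimes> c) \<oplus> r \<otimes> c = s" using s cc pr(2) by algebra
      ultimately show False using s by simp
    qed
    ultimately obtain l where l: "k = Suc (Suc l)" by (cases k; cases "k - 1") auto
    have Ml: "ideal (ideal_pow M l) R" by (rule ideal_list_prod_is_ideal) (use Mi in auto)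
    have "M \<cdot> ideal_pow M l \<subseteq> M" using ideal_prod_inter[OF Mi Ml] by blast
    from ideal_prod_mono[OF subset_refl this]
    have "ideal_pow M k \<subseteq> M \<cdot> M" unfolding l by simp
    with k(1) Q(2) have "P \<subseteq> M \<cdot> M" by blast
    also have "\<dots> \<subseteq> saturation M (P <+>\<^bsub>R\<^esub> PIdl c) \<cdot> saturation M (P <+>\<^bsub>R\<^esub> PIdl c)"
      by (rule ideal_prod_mono[OF cM cM])
    also have "\<dots> \<subseteq> saturation M ((P <+>\<^bsub>R\<^esub> PIdl c) \<cdot> (P <+>\<^bsub>R\<^esub> PIdl c))"
      by (intro saturation_prod M ideal_add_cgenideal Pi cc)
    also have "\<dots> \<subseteq> saturation M (M \<cdot> P <+>\<^bsub>R\<^esub> PIdl (c \<otimes> c))"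
    proof (intro saturation_mono ideal_prod_leI)
      interpret MP: ideal "M \<cdot> P" R by (rule ideal_prod_is_ideal[OF Mi Pi])
      show "ideal (M \<cdot> P <+>\<^bsub>R\<^esub> PIdl (c \<otimes> c)) R"
        by (rule ideal_add_cgenideal(1)[OF MP.is_ideal ccc])
      fix x y assume "x \<in> P <+>\<^bsub>R\<^esub> PIdl c" "y \<in> P <+>\<^bsub>R\<^esub> PIdl c"
      then obtain p r q t where pr: "p \<in> P" "r \<in> carrier R" "x = p \<oplus> r \<otimes> c"
        and qt: "q \<in> P" "t \<in> carrier R" "y = q \<oplus> t \<otimes> c"
        unfolding mem_add_cgenideal by blast
      have pq: "p \<in> carrier R" "q \<in> carrier R" using pr qt by auto
      have "x \<otimes> y = (p \<otimes> q \<oplus> r \<otimes> (c \<otimes> q) \<oplus> t \<otimes> (c \<otimes> p)) \<oplus> (r \<otimes> t) \<otimes> (c \<otimes> c)"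
        unfolding pr(3) qt(3) using pq pr(2) qt(2) cc by algebra
      moreover have "p \<otimes> q \<oplus> r \<otimes> (c \<otimes> q) \<oplus> t \<otimes> (c \<otimes> p) \<in> M \<cdot> P"
      proof (intro MP.a_closed)
        show "p \<otimes> q \<in> M \<cdot> P" using pr(1) qt(1) PM by (intro ideal_prod.prod) auto
        show "r \<otimes> (c \<otimes> q) \<in> M \<cdot> P" "t \<otimes> (c \<otimes> p) \<in> M \<cdot> P"
          using pr(1,2) qt(1,2) c by (simp_all add: MP.I_l_closed ideal_prod.prod)
      qed
      ultimately show "x \<otimes> y \<in> M \<cdot> P <+>\<^bsub>R\<^esub> PIdl (c \<otimes> c)"
        unfolding mem_add_cgenideal using pr(2) qt(2) by blast
    qed
    finally have Psub: "P \<subseteq> saturation M (M \<cdot> P <+>\<^bsub>R\<^esub> PIdl (c \<otimes> c))" .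
    have "P \<subseteq> saturation M (M \<cdot> P)"
    proof
      interpret MP: ideal "M \<cdot> P" R by (rule ideal_prod_is_ideal[OF Mi Pi])
      fix x assume x: "x \<in> P"
      then have "x \<in> saturation M (M \<cdot> P <+>\<^bsub>R\<^esub> PIdl (c \<otimes> c))" using Psub by blast
      then obtain s where s: "x \<in> carrier R" "s \<in> carrier R" "s \<notin> M"
        "s \<otimes> x \<in> M \<cdot> P <+>\<^bsub>R\<^esub> PIdl (c \<otimes> c)" by (rule saturationE)
      from s(4) obtain y r where yr: "y \<in> M \<cdot> P" "r \<in> carrier R" "s \<otimes> x = y \<oplus> r \<otimes> (c \<otimes> c)"
        unfolding mem_add_cgenideal by blast
      have yP: "y \<in> P" using yr(1) ideal_prod_inter[OF Mi Pi] by blast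
      have yc: "y \<in> carrier R" using yP by auto
      have "s \<otimes> x \<ominus> y \<in> P" using s x yP unfolding a_minus_def
        by (intro P.a_closed P.I_l_closed P.a_inv_closed)
      moreover have "s \<otimes> x \<ominus> y = r \<otimes> (c \<otimes> c)" unfolding yr(3) using yc yr(2) cc by algebra
      ultimately have "r \<otimes> (c \<otimes> c) \<in> P" by simp
      then have "r \<in> P"
        using P.I_prime[of r "c \<otimes> c"] P.I_prime[of c c] yr(2) cc cP by auto
      then have "c \<otimes> (c \<otimes> r) \<in> M \<cdot> P" using c cc by (intro ideal_prod.prod P.I_l_closed)
      moreover have "c \<otimes> (c \<otimes> r) = r \<otimes> (c \<otimes> c)" using cc yr(2) by algebra
      ultimately have "s \<otimes> x \<in> M \<cdot> P" unfolding yr(3) using yr(1) by (simp add: MP.a_closed)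
      then show "x \<in> saturation M (M \<cdot> P)" using s by (intro saturationI[of _ s])
    qed
    from Nakayama_saturation[OF M(1) Pi fg this] have P0: "P \<subseteq> saturation M {\<zero>}" .
    from reg obtain a where a: "a \<in> P" "a \<in> regular_elements R" by (auto simp: regular_ideal_def)
    from subsetD[OF P0 a(1)] obtain s where s: "s \<in> carrier R" "s \<notin> M" "s \<otimes> a \<in> {\<zero>}"
      by (rule saturationE)
    have "a \<otimes> s = \<zero>" using s(1,3) m_comm[of s a] P.Icarr[OF a(1)] by simp
    then have "s = \<zero>" using a(2) s(1) by (simp add: regular_elements_def)
    then show False using s M.zero_closed by simp
  qed
qed

section \<open>Regular-Noetherian SP-rings are Dedekind\<close>

text \<open>
  Noetherian induction. A maximal counterexample \<open>L\<close> is neither the whole ring nor prime, so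
  \<open>x y \<in> L\<close> with \<open>x, y \<notin> L\<close>, and \<open>(L + (x)) (L + (y)) \<subseteq> L\<close> combines the prime products found for the
  two larger ideals. Zorn's lemma applies because the union of a chain of regular ideals is finitely
  generated and thus occurs in the chain.
\<close>

lemma (in regular_noetherian_ring) regular_has_prime_product:
  assumes "regular_ideal I R"
  shows "has_prime_product I"
proof (rule ccontr)
  assume I: "\<not> has_prime_product I"
  define B where "B = {I. regular_ideal I R \<and> \<not> has_prime_product I}"
  have "B \<noteq> {}" using I assms by (auto simp: B_def)
  moreover have "\<Union>C \<in> B" if C: "C \<noteq> {}" "subset.chain B C" for C
  proof -
    have CB: "C \<subseteq> B" using C(2) by (simp add: subset.chain_def)
    have "C \<subseteq> {I. ideal I R}" using CB by (auto simp: B_def regular_ideal_def)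
    then have "subset.chain {I. ideal I R} C" using C(2) by (simp add: subset.chain_def)
    then have U: "ideal (\<Union>C) R" using chain_Union_is_ideal[of C] C(1) by simp
    obtain J where J: "J \<in> C" using C(1) by blast
    have "regular_ideal J R" using subsetD[OF CB J] by (simp add: B_def)
    then have "regular_ideal (\<Union>C) R" by (rule regular_ideal_superset[OF _ U Union_upper[OF J]])
    then obtain S where S: "S \<subseteq> carrier R" "finite S" "\<Union>C = Idl S"
      using regular_finitely_generated[of "\<Union>C"] by blast
    have "S \<subseteq> \<Union>C" unfolding S(3) by (rule genideal_self[OF S(1)])
    then obtain K where K: "K \<in> C" "S \<subseteq> K"
      by (rule finite_subset_Union_chain[OF S(2) _ C])
    have "ideal K R" using subsetD[OF CB K(1)] by (simp add: B_def regular_ideal_def)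
    then have "Idl S \<subseteq> K" using K by (intro genideal_minimal)
    then have "\<Union>C = K" using K S(3) by blast
    then show ?thesis using K CB by auto
  qed
  ultimately obtain L where L: "L \<in> B" and max: "\<And>X. X \<in> B \<Longrightarrow> L \<subseteq> X \<Longrightarrow> X = L"
    using subset_Zorn_nonempty[of B] by blast
  have Lreg: "regular_ideal L R" and bad: "\<not> has_prime_product L" using L by (auto simp: B_def)
  interpret L: ideal L R using Lreg by (simp add: regular_ideal_def)
  have "L \<noteq> carrier R"
  proof
    assume "L = carrier R"
    then have "has_prime_product L" unfolding has_prime_product_def by (intro exI[of _ "[]"]) simp
    with bad show False ..
  qed
  moreover have "\<not> primeideal L R"
  proof
    assume "primeideal L R"
    then have "has_prime_product L" unfolding has_prime_product_def
      by (intro exI[of _ "[L]"]) (simp add: ideal_prod_one L.is_ideal)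
    with bad show False ..
  qed
  ultimately have "\<not> (\<forall>x\<in>carrier R. \<forall>y\<in>carrier R. x \<otimes> y \<in> L \<longrightarrow> x \<in> L \<or> y \<in> L)"
    using primeidealI[OF L.is_ideal is_cring] by auto
  then obtain x y where x: "x \<in> carrier R" "x \<notin> L" and y: "y \<in> carrier R" "y \<notin> L"
    and xy: "x \<otimes> y \<in> L" by blast
  have larger: "\<exists>Qs. (\<forall>Q\<in>set Qs. primeideal Q R \<and> L \<subseteq> Q) \<and> ideal_list_prod R Qs \<subseteq> L <+>\<^bsub>R\<^esub> PIdl z"
    if z: "z \<in> carrier R" "z \<notin> L" for z
  proof -
    note Lz = ideal_add_cgenideal[OF L.is_ideal z(1)]
    have "L <+>\<^bsub>R\<^esub> PIdl z \<notin> B" using max[OF _ Lz(2)] Lz(3) z(2) by auto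
    then have "has_prime_product (L <+>\<^bsub>R\<^esub> PIdl z)"
      using regular_ideal_superset[OF Lreg Lz(1,2)] by (simp add: B_def)
    then show ?thesis using Lz(2) unfolding has_prime_product_def by blast
  qed
  from larger[OF x] larger[OF y] obtain Qs Qs' where
    Q: "\<forall>Q\<in>set Qs. primeideal Q R \<and> L \<subseteq> Q" "ideal_list_prod R Qs \<subseteq> L <+>\<^bsub>R\<^esub> PIdl x"
    and Q': "\<forall>Q\<in>set Qs'. primeideal Q R \<and> L \<subseteq> Q" "ideal_list_prod R Qs' \<subseteq> L <+>\<^bsub>R\<^esub> PIdl y"
    by blast
  have "(L <+>\<^bsub>R\<^esub> PIdl x) \<cdot> (L <+>\<^bsub>R\<^esub> PIdl y) \<subseteq> L"
  proof (rule ideal_prod_leI[OF L.is_ideal])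
    fix u v assume "u \<in> L <+>\<^bsub>R\<^esub> PIdl x" "v \<in> L <+>\<^bsub>R\<^esub> PIdl y"
    then obtain p r q t where pr: "p \<in> L" "r \<in> carrier R" "u = p \<oplus> r \<otimes> x"
      and qt: "q \<in> L" "t \<in> carrier R" "v = q \<oplus> t \<otimes> y"
      unfolding mem_add_cgenideal by blast
    have pq: "p \<in> carrier R" "q \<in> carrier R" using pr(1) qt(1) L.Icarr by auto
    have "u \<otimes> v = v \<otimes> p \<oplus> (r \<otimes> x) \<otimes> q \<oplus> (r \<otimes> t) \<otimes> (x \<otimes> y)"
      unfolding pr(3) qt(3) using pq pr(2) qt(2) x(1) y(1) by algebra
    also have "\<dots> \<in> L" using pq pr(1,2) qt x(1) y(1) xy by (simp add: L.a_closed L.I_l_closed)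
    finally show "u \<otimes> v \<in> L" .
  qed
  then have "ideal_list_prod R Qs \<cdot> ideal_list_prod R Qs' \<subseteq> L"
    using ideal_prod_mono[OF Q(2) Q'(2)] by (rule subset_trans[rotated])
  moreover have "\<forall>Q\<in>set Qs. ideal Q R" "\<forall>Q\<in>set Qs'. ideal Q R"
    using Q(1) Q'(1) primeideal.axioms(1) by blast+
  ultimately have "ideal_list_prod R (Qs @ Qs') \<subseteq> L"
    by (simp add: ideal_list_prod_append)
  then have "has_prime_product L"
    unfolding has_prime_product_def using Q(1) Q'(1) by (intro exI[of _ "Qs @ Qs'"]) auto
  with bad show False ..
qed

text \<open>
  Distinct maximal ideals are comaximal, so their product is their intersection.
\<close>

lemma (in cring) distinct_maximal_prod:
  assumes "distinct Qs" "\<forall>Q\<in>set Qs. maximalideal Q R" "x \<in> carrier R" "\<forall>Q\<in>set Qs. x \<in> Q"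
  shows "x \<in> ideal_list_prod R Qs"
  using assms
proof (induct Qs)
  case (Cons Q Qs)
  let ?K = "ideal_list_prod R Qs"
  have Q: "maximalideal Q R" using Cons by simp
  interpret Q: maximalideal Q R by (rule Q)
  have ids: "\<forall>Q\<in>set Qs. ideal Q R" using Cons(3) maximalideal.axioms(1) by auto
  have K: "ideal ?K R" by (rule ideal_list_prod_is_ideal[OF ids])
  interpret K: ideal ?K R by (rule K)
  have "\<not> ?K \<subseteq> Q"
  proof
    assume "?K \<subseteq> Q"
    then obtain Q' where Q': "Q' \<in> set Qs" "Q' \<subseteq> Q"
      using primeideal_contains_factor[OF maximalideal_prime[OF Q] ids] by blast
    have "maximalideal Q' R" using Q' Cons(3) by simp
    then have "Q = Q' \<or> Q = carrier R"
      using Q'(2) Q.is_ideal Q.a_subset by (intro maximalideal.I_maximal) auto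
    with Q'(1) Cons(2) Q.I_notcarr show False by auto
  qed
  moreover have "Q \<subseteq> Q <+>\<^bsub>R\<^esub> ?K" "?K \<subseteq> Q <+>\<^bsub>R\<^esub> ?K"
  proof -
    have "a \<oplus> \<zero> \<in> Q <+>\<^bsub>R\<^esub> ?K" if "a \<in> Q" for a
      unfolding set_add_def' using that K.zero_closed by blast
    then show "Q \<subseteq> Q <+>\<^bsub>R\<^esub> ?K" using Q.Icarr by auto
    have "\<zero> \<oplus> a \<in> Q <+>\<^bsub>R\<^esub> ?K" if "a \<in> ?K" for a
      unfolding set_add_def' using that Q.zero_closed by blast
    then show "?K \<subseteq> Q <+>\<^bsub>R\<^esub> ?K" using K.Icarr by auto
  qed
  moreover have S: "ideal (Q <+>\<^bsub>R\<^esub> ?K) R" by (rule add_ideals[OF Q.is_ideal K])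
  moreover have "Q <+>\<^bsub>R\<^esub> ?K \<subseteq> carrier R" using S by (meson additive_subgroup.a_subset ideal.axioms(1))
  ultimately have "Q <+>\<^bsub>R\<^esub> ?K = carrier R"
    using Q.I_maximal[OF S] by auto
  then have "Q \<cdot> ?K = Q \<inter> ?K" by (rule ideal_prod_eq_inter[OF Q.is_ideal K])
  then show ?case using Cons by simp
qed simp

lemma (in cring) pow_length_mem_prod:
  assumes "x \<in> carrier R" "\<forall>Q\<in>set Qs. x \<in> Q"
  shows "x [^] length Qs \<in> ideal_list_prod R Qs"
  using assms(2)
proof (induct Qs)
  case (Cons Q Qs)
  then have "x \<otimes> x [^] length Qs \<in> Q \<cdot> ideal_list_prod R Qs" by (intro ideal_prod.prod) auto
  moreover have "x \<otimes> x [^] length Qs = x [^] length (Q # Qs)"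
    using assms(1) by (simp add: m_comm)
  ultimately show ?case by simp
qed simp

text \<open>
  If \<open>x\<close> lies in all the maximal ideals, then a power of \<open>x\<close> lies in their product, hence in \<open>J\<close>. So
  \<open>J\<close> is their intersection, which is the product of the distinct ones.
\<close>

lemma (in cring) radical_eq_prod_maximal:
  assumes J: "radical_ideal J R"
    and Qs: "\<forall>Q\<in>set Qs. maximalideal Q R \<and> J \<subseteq> Q" "ideal_list_prod R Qs \<subseteq> J"
  shows "J = ideal_list_prod R (remdups Qs)"
proof
  interpret J: ideal J R using J by (simp add: radical_ideal_def)
  show "J \<subseteq> ideal_list_prod R (remdups Qs)"
    using Qs(1) J.Icarr by (intro subsetI distinct_maximal_prod) auto
  have ids: "\<forall>Q\<in>set (remdups Qs). ideal Q R" using Qs(1) maximalideal.axioms(1) by auto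
  interpret K: ideal "ideal_list_prod R (remdups Qs)" R by (rule ideal_list_prod_is_ideal[OF ids])
  show "ideal_list_prod R (remdups Qs) \<subseteq> J"
  proof
    fix x assume x: "x \<in> ideal_list_prod R (remdups Qs)"
    then have xc: "x \<in> carrier R" by (rule K.Icarr)
    have "\<forall>Q\<in>set Qs. x \<in> Q"
      using x ideal_list_prod_subset_factor[OF ids] by auto
    from pow_length_mem_prod[OF xc this] Qs(2) have "x [^] length Qs \<in> J" by blast
    then show "x \<in> J" by (rule radical_ideal_memI[OF J xc])
  qed
qed

lemma (in cring) prod_of_prime_products:
  assumes "\<forall>J\<in>set Js. \<exists>Ps. (\<forall>P\<in>set Ps. primeideal P R) \<and> J = ideal_list_prod R Ps"
  shows "\<exists>Ps. (\<forall>P\<in>set Ps. primeideal P R) \<and> ideal_list_prod R Js = ideal_list_prod R Ps"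
  using assms
proof (induct Js)
  case Nil
  show ?case by (rule exI[of _ "[]"]) simp
next
  case (Cons J Js)
  from Cons(1) Cons(2) obtain Ps where Ps: "\<forall>P\<in>set Ps. primeideal P R"
    "ideal_list_prod R Js = ideal_list_prod R Ps" by auto
  from Cons(2) obtain Qs where Qs: "\<forall>P\<in>set Qs. primeideal P R" "J = ideal_list_prod R Qs" by auto
  have "\<forall>P\<in>set Qs. ideal P R" "\<forall>P\<in>set Ps. ideal P R"
    using Ps(1) Qs(1) primeideal.axioms(1) by auto
  then have "ideal_list_prod R (J # Js) = ideal_list_prod R (Qs @ Ps)"
    unfolding ideal_list_prod_Cons Ps(2) Qs(2) by (simp add: ideal_list_prod_append)
  moreover have "\<forall>P\<in>set (Qs @ Ps). primeideal P R" using Ps(1) Qs(1) by auto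
  ultimately show ?case by blast
qed

text \<open>
  It is enough to factor the radical factors of a regular ideal. Each of them contains a product of
  regular primes above it, and these primes are finitely generated, hence maximal.
\<close>

lemma (in cring) dedekind_if_noetherian_sp:
  assumes "regular_noetherian_ring R" "sp_ring R"
  shows "dedekind_ring R"
proof -
  interpret N: regular_noetherian_ring R by fact
  interpret SP: sp_ring R by fact
  show ?thesis
  proof
    fix I assume I: "regular_ideal I R"
    from SP.radical_factorization[OF I] obtain Js
      where Js: "\<forall>J\<in>set Js. radical_ideal J R" "I = ideal_list_prod R Js" by blast
    have ids: "\<forall>J\<in>set Js. ideal J R" using Js(1) by (simp add: radical_ideal_def)
    have "\<exists>Ps. (\<forall>P\<in>set Ps. primeideal P R) \<and> J = ideal_list_prod R Ps" if J: "J \<in> set Js" for J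
    proof -
      have Ji: "ideal J R" and Jr: "radical_ideal J R" using J ids Js(1) by auto
      have "I \<subseteq> J" unfolding Js(2) by (rule ideal_list_prod_subset_factor[OF ids J])
      then have Jreg: "regular_ideal J R" by (rule regular_ideal_superset[OF I Ji])
      from N.regular_has_prime_product[OF Jreg] obtain Qs
        where Qs: "\<forall>Q\<in>set Qs. primeideal Q R \<and> J \<subseteq> Q" "ideal_list_prod R Qs \<subseteq> J"
        unfolding has_prime_product_def by blast
      have max: "maximalideal Q R" if Q: "Q \<in> set Qs" for Q
      proof -
        have Qp: "primeideal Q R" and JQ: "J \<subseteq> Q" using Qs(1) Q by auto
        have Qreg: "regular_ideal Q R"
          by (rule regular_ideal_superset[OF Jreg primeideal.axioms(1)[OF Qp] JQ])
        from N.regular_finitely_generated[OF Qreg] obtain S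
          where "S \<subseteq> carrier R" "finite S" "Q = Idl S" by blast
        with Qp Qreg N.regular_has_prime_product show ?thesis
          by (intro SP.fg_regular_prime_maximal)
      qed
      then have "\<forall>Q\<in>set Qs. maximalideal Q R \<and> J \<subseteq> Q" using Qs(1) by blast
      then have "J = ideal_list_prod R (remdups Qs)"
        by (rule radical_eq_prod_maximal[OF Jr _ Qs(2)])
      moreover have "\<forall>P\<in>set (remdups Qs). primeideal P R" using Qs(1) by simp
      ultimately show ?thesis by blast
    qed
    then show "\<exists>Ps. (\<forall>P\<in>set Ps. primeideal P R) \<and> I = ideal_list_prod R Ps"
      unfolding Js(2) by (intro prod_of_prime_products) blast
  qed
qed

section \<open>Dedekind rings are regular-Noetherian SP-rings\<close>

lemma (in cring) cgenideal_ideal_prod: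
  assumes "a \<in> carrier R" "b \<in> carrier R"
  shows "(PIdl a) \<cdot> (PIdl b) = PIdl (a \<otimes> b)"
proof -
  have "(PIdl a) \<cdot> (PIdl b) = Idl (PIdl (a \<otimes> b))"
    using assms by (simp add: ideal_prod_eq_genideal cgenideal_ideal cgenideal_prod)
  also have "\<dots> = PIdl (a \<otimes> b)"
  proof
    have id: "ideal (PIdl (a \<otimes> b)) R" using assms by (intro cgenideal_ideal) simp
    show "Idl (PIdl (a \<otimes> b)) \<subseteq> PIdl (a \<otimes> b)" by (rule genideal_minimal[OF id]) simp
    show "PIdl (a \<otimes> b) \<subseteq> Idl (PIdl (a \<otimes> b))"
      using id by (intro genideal_self) (meson additive_subgroup.a_subset ideal.axioms(1))
  qed
  finally show ?thesis .
qed

lemma (in cring) regular_elements_mult: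
  assumes "a \<in> regular_elements R" "b \<in> regular_elements R"
  shows "a \<otimes> b \<in> regular_elements R"
proof -
  have ab: "a \<in> carrier R" "b \<in> carrier R" using assms by (simp_all add: regular_elements_def)
  have "x = \<zero>" if x: "x \<in> carrier R" "(a \<otimes> b) \<otimes> x = \<zero>" for x
  proof -
    have "a \<otimes> (b \<otimes> x) = \<zero>" using x ab by (simp add: m_assoc)
    then have "b \<otimes> x = \<zero>" using assms(1) ab(2) x(1) by (simp add: regular_elements_def)
    then show ?thesis using assms(2) x(1) by (simp add: regular_elements_def)
  qed
  then show ?thesis using ab unfolding regular_elements_def by simp
qed

text \<open>
  Equivalently, \<open>J\<close> is an invertible ideal: \<open>a\<^sup>-\<^sup>1 K\<close> is its inverse in the total ring of fractions.
\<close>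

definition (in cring) divides_regular_principal :: "'a set \<Rightarrow> bool" where
  "divides_regular_principal J \<longleftrightarrow>
     (\<exists>K a. ideal K R \<and> a \<in> regular_elements R \<and> J \<cdot> K = PIdl a)"

text \<open>
  Write \<open>a\<close> as the sum of \<open>j\<^sub>i k\<^sub>i\<close> with \<open>j\<^sub>i \<in> J\<close> and \<open>k\<^sub>i \<in> K\<close>. For \<open>x \<in> J\<close> each \<open>x k\<^sub>i\<close> lies
  in \<open>(a)\<close>, say \<open>x k\<^sub>i = r\<^sub>i a\<close>. Then \<open>a x\<close> is \<open>a\<close> times the sum of the \<open>r\<^sub>i j\<^sub>i\<close>, and cancelling \<open>a\<close>
  shows that the \<open>j\<^sub>i\<close> generate \<open>J\<close>.
\<close>

lemma (in cring) divides_regular_principal_fg: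
  assumes J: "ideal J R" and div: "divides_regular_principal J"
  shows "\<exists>S\<subseteq>carrier R. finite S \<and> J = Idl S"
proof -
  interpret J: ideal J R by fact
  from div obtain K a where K: "ideal K R" and a: "a \<in> regular_elements R"
    and JK: "J \<cdot> K = PIdl a" by (auto simp: divides_regular_principal_def)
  interpret K: ideal K R by fact
  have ac: "a \<in> carrier R" using a by (simp add: regular_elements_def)
  \<comment> \<open>Induction over the construction of \<open>z\<close> as a sum of products collects the generators \<open>j\<^sub>i\<close>.\<close>
  have "\<exists>F. finite F \<and> F \<subseteq> J \<and> (\<forall>x\<in>J. \<exists>w\<in>Idl F. z \<otimes> x = a \<otimes> w)" if "z \<in> J \<cdot> K" for z
    using that
  proof induct
    case (prod j k)
    have c: "j \<in> carrier R" "k \<in> carrier R" using prod J.Icarr K.Icarr by auto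
    have "\<exists>w\<in>Idl {j}. (j \<otimes> k) \<otimes> x = a \<otimes> w" if x: "x \<in> J" for x
    proof -
      have xc: "x \<in> carrier R" using x by (rule J.Icarr)
      have "x \<otimes> k \<in> PIdl a" unfolding JK[symmetric] using x prod(2) by (rule ideal_prod.prod)
      then obtain r where r: "r \<in> carrier R" "x \<otimes> k = r \<otimes> a" by (auto simp: cgenideal_def)
      have "(j \<otimes> k) \<otimes> x = j \<otimes> (x \<otimes> k)" using c xc by algebra
      also have "\<dots> = a \<otimes> (r \<otimes> j)" unfolding r(2) using c r(1) ac by algebra
      finally have "(j \<otimes> k) \<otimes> x = a \<otimes> (r \<otimes> j)" .
      moreover have "r \<otimes> j \<in> Idl {j}"
        unfolding cgenideal_eq_genideal[OF c(1), symmetric] cgenideal_def using r(1) by blast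
      ultimately show ?thesis by blast
    qed
    then show ?case using prod(1) by (intro exI[of _ "{j}"]) simp
  next
    case (sum z1 z2)
    then obtain F G where F: "finite F" "F \<subseteq> J" "\<forall>x\<in>J. \<exists>w\<in>Idl F. z1 \<otimes> x = a \<otimes> w"
      and G: "finite G" "G \<subseteq> J" "\<forall>x\<in>J. \<exists>w\<in>Idl G. z2 \<otimes> x = a \<otimes> w" by blast
    have FGc: "F \<union> G \<subseteq> carrier R" using F(2) G(2) J.a_subset by blast
    interpret FG: ideal "Idl (F \<union> G)" R by (rule genideal_ideal[OF FGc])
    have zc: "z1 \<in> carrier R" "z2 \<in> carrier R"
      using sum(1,3) ideal_prod_in_carrier[OF J K] by auto
    have "\<exists>w\<in>Idl (F \<union> G). (z1 \<oplus> z2) \<otimes> x = a \<otimes> w" if x: "x \<in> J" for x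
    proof -
      have xc: "x \<in> carrier R" using x by (rule J.Icarr)
      from F(3) x obtain w where w: "w \<in> Idl F" "z1 \<otimes> x = a \<otimes> w" by blast
      from G(3) x obtain v where v: "v \<in> Idl G" "z2 \<otimes> x = a \<otimes> v" by blast
      have wv: "w \<in> Idl (F \<union> G)" "v \<in> Idl (F \<union> G)"
        using subset_Idl_subset[OF FGc, of F] subset_Idl_subset[OF FGc, of G] w(1) v(1) by auto
      have wvc: "w \<in> carrier R" "v \<in> carrier R" using wv FG.Icarr by auto
      have "(z1 \<oplus> z2) \<otimes> x = z1 \<otimes> x \<oplus> z2 \<otimes> x" using zc xc by (rule l_distr)
      also have "\<dots> = a \<otimes> (w \<oplus> v)" unfolding w(2) v(2) using ac wvc by (simp add: r_distr)
      finally show ?thesis using FG.a_closed[OF wv] by blast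
    qed
    then show ?case using F(1,2) G(1,2) by (intro exI[of _ "F \<union> G"]) simp
  qed
  from this[of a] obtain F where F: "finite F" "F \<subseteq> J" "\<forall>x\<in>J. \<exists>w\<in>Idl F. a \<otimes> x = a \<otimes> w"
    unfolding JK using cgenideal_self[OF ac] by blast
  have Fc: "F \<subseteq> carrier R" using F(2) J.a_subset by blast
  interpret F: ideal "Idl F" R by (rule genideal_ideal[OF Fc])
  have "J \<subseteq> Idl F"
  proof
    fix x assume x: "x \<in> J"
    then obtain w where w: "w \<in> Idl F" "a \<otimes> x = a \<otimes> w" using F(3) by blast
    have xw: "x \<in> carrier R" "w \<in> carrier R" using x w(1) J.Icarr F.Icarr by auto
    have "a \<otimes> (x \<ominus> w) = a \<otimes> x \<ominus> a \<otimes> w" using xw ac by algebra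
    also have "\<dots> = \<zero>" unfolding w(2) using xw ac by algebra
    finally have "x \<ominus> w = \<zero>" using a xw by (simp add: regular_elements_def)
    then have "x = w" using xw by simp
    then show "x \<in> Idl F" using w(1) by simp
  qed
  moreover have "Idl F \<subseteq> J" by (rule genideal_minimal[OF J F(2)])
  ultimately show ?thesis using F(1) Fc by blast
qed

lemma (in cring) divides_regular_principal_prod:
  assumes "\<forall>J\<in>set Js. ideal J R \<and> divides_regular_principal J"
  shows "divides_regular_principal (ideal_list_prod R Js)"
  using assms
proof (induct Js)
  case Nil
  have "carrier R = PIdl \<one>"
    using cgenideal_eq_genideal[of \<one>] genideal_one by simp
  then have "carrier R \<cdot> carrier R = PIdl \<one>"
    using ideal_prod_one[OF oneideal] by simp
  moreover have "\<one> \<in> regular_elements R" by (simp add: regular_elements_def)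
  ultimately show ?case
    unfolding divides_regular_principal_def ideal_list_prod_Nil using oneideal by blast
next
  case (Cons J Js)
  let ?I = "ideal_list_prod R Js"
  have J: "ideal J R" and I: "ideal ?I R" using Cons(2) by (auto intro: ideal_list_prod_is_ideal)
  from Cons(2) obtain K a where K: "ideal K R" "a \<in> regular_elements R" "J \<cdot> K = PIdl a"
    by (auto simp: divides_regular_principal_def)
  from Cons obtain L b where L: "ideal L R" "b \<in> regular_elements R" "?I \<cdot> L = PIdl b"
    by (auto simp: divides_regular_principal_def)
  have "(J \<cdot> ?I) \<cdot> (K \<cdot> L) = (J \<cdot> K) \<cdot> (?I \<cdot> L)"
  proof -
    have "(J \<cdot> ?I) \<cdot> (K \<cdot> L) = J \<cdot> ((?I \<cdot> K) \<cdot> L)"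
      by (simp add: ideal_prod_assoc ideal_prod_is_ideal J I K(1) L(1))
    also have "\<dots> = J \<cdot> ((K \<cdot> ?I) \<cdot> L)" unfolding ideal_prod_commute[OF I K(1)] ..
    also have "\<dots> = (J \<cdot> K) \<cdot> (?I \<cdot> L)"
      by (simp add: ideal_prod_assoc ideal_prod_is_ideal J I K(1) L(1))
    finally show ?thesis .
  qed
  also have "\<dots> = PIdl (a \<otimes> b)"
    unfolding K(3) L(3) using K(2) L(2)
    by (intro cgenideal_ideal_prod) (simp_all add: regular_elements_def)
  finally show ?case
    unfolding divides_regular_principal_def ideal_list_prod_Cons
    using regular_elements_mult[OF K(2) L(2)] ideal_prod_is_ideal[OF K(1) L(1)] by blast
qed

lemma (in dedekind_ring) is_sp_ring: "sp_ring R"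
proof
  fix I assume "regular_ideal I R"
  from prime_factorization[OF this]
  show "\<exists>Js. (\<forall>J\<in>set Js. radical_ideal J R) \<and> I = ideal_list_prod R Js"
    using prime_imp_radical by blast
qed

text \<open>
  Take a regular \<open>a \<in> P\<close>. One of the prime factors \<open>Q\<close> of \<open>(a)\<close> lies in \<open>P\<close>. As a divisor of \<open>(a)\<close>
  it is finitely generated, hence maximal, and so \<open>P = Q\<close>.
\<close>

lemma (in dedekind_ring) regular_prime_divides_regular_principal:
  assumes P: "primeideal P R" and reg: "regular_ideal P R"
  shows "divides_regular_principal P"
proof -
  interpret SP: sp_ring R by (rule is_sp_ring)
  interpret P: primeideal P R by (rule P)
  have pp: "has_prime_product I" if "regular_ideal I R" for I
  proof -
    from prime_factorization[OF that] obtain Ps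
      where Ps: "\<forall>P\<in>set Ps. primeideal P R" "I = ideal_list_prod R Ps" by blast
    have "\<forall>P\<in>set Ps. ideal P R" using Ps(1) primeideal.axioms(1) by blast
    from ideal_list_prod_subset_factor[OF this] Ps show ?thesis
      unfolding has_prime_product_def by (intro exI[of _ Ps]) simp
  qed
  from reg obtain a where a: "a \<in> P" "a \<in> regular_elements R" by (auto simp: regular_ideal_def)
  have ac: "a \<in> carrier R" using a(1) by (rule P.Icarr)
  have aid: "ideal (PIdl a) R" by (rule cgenideal_ideal[OF ac])
  have areg: "regular_ideal (PIdl a) R"
    using aid a(2) cgenideal_self[OF ac] by (auto simp: regular_ideal_def)
  from prime_factorization[OF areg] obtain Ps
    where Ps: "\<forall>Q\<in>set Ps. primeideal Q R" "PIdl a = ideal_list_prod R Ps" by blast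
  have ids: "\<forall>Q\<in>set Ps. ideal Q R" using Ps(1) primeideal.axioms(1) by blast
  have "ideal_list_prod R Ps \<subseteq> P"
    unfolding Ps(2)[symmetric] by (rule cgenideal_minimal[OF P.is_ideal a(1)])
  from primeideal_contains_factor[OF P ids this]
  obtain Q where Q: "Q \<in> set Ps" "Q \<subseteq> P" by blast
  have Qi: "ideal Q R" and Qp: "primeideal Q R" using Q(1) ids Ps(1) by auto
  from ideal_list_prod_remove_factor[OF ids Q(1)]
  have div: "divides_regular_principal Q"
    unfolding divides_regular_principal_def Ps(2)[symmetric] using a(2) by metis
  have "PIdl a \<subseteq> Q" unfolding Ps(2) by (rule ideal_list_prod_subset_factor[OF ids Q(1)])
  then have Qreg: "regular_ideal Q R" by (rule regular_ideal_superset[OF areg Qi])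
  from divides_regular_principal_fg[OF Qi div] obtain S
    where S: "S \<subseteq> carrier R" "finite S" "Q = Idl S" by blast
  have "maximalideal Q R" by (rule SP.fg_regular_prime_maximal[OF Qp Qreg S(2,1,3) pp])
  then have "P = Q \<or> P = carrier R"
    using P.is_ideal Q(2) P.a_subset by (rule maximalideal.I_maximal)
  then show ?thesis using div P.I_notcarr by auto
qed

lemma (in dedekind_ring) is_regular_noetherian_ring: "regular_noetherian_ring R"
proof
  fix I assume I: "regular_ideal I R"
  from prime_factorization[OF I] obtain Ps
    where Ps: "\<forall>P\<in>set Ps. primeideal P R" "I = ideal_list_prod R Ps" by blast
  have ids: "\<forall>P\<in>set Ps. ideal P R" using Ps(1) primeideal.axioms(1) by blast
  have "divides_regular_principal P" if P: "P \<in> set Ps" for P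
  proof (rule regular_prime_divides_regular_principal)
    show "primeideal P R" using Ps(1) P by blast
    have "I \<subseteq> P" unfolding Ps(2) by (rule ideal_list_prod_subset_factor[OF ids P])
    then show "regular_ideal P R" using ids P by (intro regular_ideal_superset[OF I]) auto
  qed
  then have "divides_regular_principal I"
    unfolding Ps(2) using ids by (intro divides_regular_principal_prod) blast
  moreover have "ideal I R" using I by (simp add: regular_ideal_def)
  ultimately show "\<exists>S\<subseteq>carrier R. finite S \<and> I = Idl S"
    by (intro divides_regular_principal_fg)
qed

theorem corollary2p7:
  fixes A :: "('a, 'b) ring_scheme"
  assumes "marot_ring A"
  shows "(regular_noetherian_ring A \<and> sp_ring A) \<longleftrightarrow> dedekind_ring A"
proof -
  interpret cring A using assms by (rule marot_ring.axioms)
  show ?thesis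
    using dedekind_if_noetherian_sp dedekind_ring.is_sp_ring
      dedekind_ring.is_regular_noetherian_ring by blast
qed

end
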